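(* Let $\alpha<0$ be real, let $n\ge N_\alpha$ be an integer, let $j$ be even with $4\le j\le n$, and let $y_{\alpha,n,j}^{(0)}=d_{n,j}$. Define the sequence $(y_{\alpha,n,j}^{(m)})_{m=0}^\infty$ by $$y_{\alpha,n,j}^{(m)}=y_{\alpha,n,j}^{(m-1)}-\frac{h_{\alpha,n,j}\left(y_{\alpha,n,j}^{(m-1)}\right)}{h_{\alpha,n,j}'\left(y_{\alpha,n,j}^{(m-1)}\right)}\qquad(m\ge1).$$ Then $(y_{\alpha,n,j}^{(m)})_{m=0}^\infty$ is well defined and converges to $z_{\alpha,n,j}$, and the convergence is at least linear: for every $m\ge0$, $$y_{\alpha,n,j}^{(m)}-z_{\alpha,n,j}\le\frac{\pi}{n}\left(\frac{\varkappa_\alpha^2-1}{\varkappa_\alpha n-1}\right)^m.$$ Moreover, if $n\ge2N_\alpha$, then the convergence is quadratic, and for every $m\ge0$, $$y_{\alpha,n,j}^{(m)}-z_{\alpha,n,j}\le\frac{\pi}{n}\left(\frac{\pi\varkappa_\alpha^2}{2n^2}\right)^{2^m-1}.$$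
   Context: For an integer $n\ge3$ and real $\alpha<0$, $L_{\alpha,n}$ is the real symmetric $n\times n$ matrix whose entries are: $(1,1)$ and $(n,n)$ entries equal to $1+\alpha$; $(1,n)$ and $(n,1)$ entries equal to $-\alpha$; $(k,k)$ entries equal to $2$ for $2\le k\le n-1$; $(k,k+1)$ and $(k+1,k)$ entries equal to $-1$ for $1\le k\le n-1$; all other entries $0$. Its eigenvalues, counted with multiplicity, are $\lambda_{\alpha,n,1}\le\dots\le\lambda_{\alpha,n,n}$. Put $\varkappa_\alpha=\frac{\alpha-1}{\alpha}>1$, $N_\alpha=\max\{3,\lfloor\varkappa_\alpha\rfloor+1\}$, $d_{n,j}=\frac{(j-1)\pi}{n}$, and $\eta_\alpha(x)=2\arctan\left(\varkappa_\alpha\tan\frac{x}{2}\right)-\pi$ for $x\in[0,\pi]$ (with $\eta_\alpha(\pi)=0$ by continuity). For $n\ge N_\alpha$ and $j\ge2$ one has $\lambda_{\alpha,n,j}\in[0,4]$, and $z_{\alpha,n,j}\in[0,\pi]$ is defined by $4\sin^2(z_{\alpha,n,j}/2)=\lambda_{\alpha,n,j}$. The function $h_{\alpha,n,j}\colon[d_{n,j-1},d_{n,j}]\to\mathbb{R}$ is $h_{\alpha,n,j}(x)=nx-(j-1)\pi-\eta_\alpha(x)$. *)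

theory Defs
  imports "HOL-Analysis.Derivative" "Jordan_Normal_Form.Char_Poly"
begin

text \<open>Rows and columns are numbered from 0, so row \<open>n - 1\<close> is the last one.\<close>

definition L_mat :: "real \<Rightarrow> nat \<Rightarrow> real mat" where
  "L_mat \<alpha> n = mat n n (\<lambda>(i, k).
     if i = k then (if i = 0 \<or> i = n - 1 then 1 + \<alpha> else 2)
     else if (i = 0 \<and> k = n - 1) \<or> (i = n - 1 \<and> k = 0) then - \<alpha>
     else if k = i + 1 \<or> i = k + 1 then - 1
     else 0)"

text \<open>\<open>eigval \<alpha> n j\<close> is the \<open>j\<close>-th smallest eigenvalue with \<open>1 \<le> j \<le> n\<close>, counted with
  algebraic multiplicity (which for a real symmetric matrix is the geometric one).\<close>

definition eigval :: "real \<Rightarrow> nat \<Rightarrow> nat \<Rightarrow> real" where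
  "eigval \<alpha> n j = sorted_list_of_multiset (proots (char_poly (L_mat \<alpha> n))) ! (j - 1)"

definition kap :: "real \<Rightarrow> real" where
  "kap \<alpha> = (\<alpha> - 1) / \<alpha>"

definition N_min :: "real \<Rightarrow> nat" where
  "N_min \<alpha> = max 3 (nat \<lfloor>kap \<alpha>\<rfloor> + 1)"

definition d :: "nat \<Rightarrow> nat \<Rightarrow> real" where
  "d n j = (real j - 1) * pi / real n"

text \<open>The value at \<open>pi\<close> is the limit; the formula would give \<open>- pi\<close> there because
  \<open>tan (pi / 2) = 0\<close>. Only arguments in \<open>{0..pi}\<close> are meaningful.\<close>

definition eta :: "real \<Rightarrow> real \<Rightarrow> real" where
  "eta \<alpha> x = (if x = pi then 0 else 2 * arctan (kap \<alpha> * tan (x / 2)) - pi)"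

definition eig_angle :: "real \<Rightarrow> nat \<Rightarrow> nat \<Rightarrow> real" where
  "eig_angle \<alpha> n j = (THE z. z \<in> {0..pi} \<and> 4 * (sin (z / 2))\<^sup>2 = eigval \<alpha> n j)"

text \<open>The function \<open>h \<alpha> n j\<close> is considered on \<open>h_dom n j\<close> only; its derivative is accordingly
  taken within this interval, so it is one-sided at the endpoints.\<close>

definition h_dom :: "nat \<Rightarrow> nat \<Rightarrow> real set" where
  "h_dom n j = {d n (j - 1)..d n j}"

definition h :: "real \<Rightarrow> nat \<Rightarrow> nat \<Rightarrow> real \<Rightarrow> real" where
  "h \<alpha> n j x = real n * x - (real j - 1) * pi - eta \<alpha> x"

definition h_deriv :: "real \<Rightarrow> nat \<Rightarrow> nat \<Rightarrow> real \<Rightarrow> real" where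
  "h_deriv \<alpha> n j x = vector_derivative (h \<alpha> n j) (at x within h_dom n j)"

primrec newton :: "real \<Rightarrow> nat \<Rightarrow> nat \<Rightarrow> nat \<Rightarrow> real" where
  "newton \<alpha> n j 0 = d n j"
| "newton \<alpha> n j (Suc m) =
     newton \<alpha> n j m - h \<alpha> n j (newton \<alpha> n j m) / h_deriv \<alpha> n j (newton \<alpha> n j m)"

text \<open>Since all functions are total, well-definedness of the sequence has to be said explicitly:
  the iterates never leave the domain of \<open>h \<alpha> n j\<close>, and there the derivative exists and is
  nonzero.\<close>

definition newton_well_defined :: "real \<Rightarrow> nat \<Rightarrow> nat \<Rightarrow> bool" where
  "newton_well_defined \<alpha> n j \<longleftrightarrow>
     (\<forall>m. newton \<alpha> n j m \<in> h_dom n j \<and>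
          h \<alpha> n j differentiable (at (newton \<alpha> n j m) within h_dom n j) \<and>
          h_deriv \<alpha> n j (newton \<alpha> n j m) \<noteq> 0)"

text \<open>The usual notion of order of convergence in numerical analysis (at least order \<open>p\<close>):
  \<open>p = 1\<close> is linear and \<open>p = 2\<close> is quadratic convergence.\<close>

definition converges_with_order :: "nat \<Rightarrow> (nat \<Rightarrow> real) \<Rightarrow> real \<Rightarrow> bool" where
  "converges_with_order p y l \<longleftrightarrow>
     y \<longlonglongrightarrow> l \<and>
     (\<exists>c>0. (p = 1 \<longrightarrow> c < 1) \<and> (\<forall>m. \<bar>y (Suc m) - l\<bar> \<le> c * \<bar>y m - l\<bar> ^ p))"

end

theory Submission
  imports Defs
begin

text \<open>
  Write \<open>k = kap \<alpha> > 1\<close>. The matrix is invariant under reversing the order of the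
  indices, so its eigenvectors can be sought among the vectors that reversal fixes or negates; for
  these, the first and the last row of the eigenvalue equation are equivalent. The interior rows
  for the eigenvalue \<open>2 - 2 cos x\<close> form a linear recursion solved by cosines and sines. The symmetric ansatz \<open>cos ((i - (n + 1) / 2) x)\<close> works when \<open>sin (n x / 2) = 0\<close>,
  that is, for \<open>x = d n j\<close> with \<open>j\<close> odd. The antisymmetric ansatz \<open>sin ((i - (n + 1) / 2) x)\<close>
  works when \<open>tan (n x / 2) = k tan (x / 2)\<close>; for even \<open>j\<close> this equation is implied by
  \<open>h \<alpha> n j x = 0\<close>. For even \<open>j \<ge> 4\<close> the bounds \<open>- pi < eta \<alpha> x < 0\<close> force a sign change of
  \<open>h \<alpha> n j\<close> on its domain, hence a root. For \<open>j = 2\<close> the only root is 0, where the sine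
  ansatz vanishes identically; because \<open>n > k\<close>, the missing antisymmetric eigenvector is hyperbolic and its eigenvalue is negative.
  So the ranks are shifted: the negative eigenvalue comes first, the eigenvalue 0 second, and for
  \<open>j \<ge> 3\<close> the \<open>j\<close>-th one has its angle in the half-open interval from \<open>d n (j - 1)\<close>
  (excluded) to \<open>d n j\<close> (included). These are \<open>n\<close> distinct roots of a polynomial of degree \<open>n\<close>,
  therefore all of them, and \<open>eig_angle \<alpha> n j\<close> is a root of \<open>h \<alpha> n j\<close>
  (lemma \<open>eig_angle_h_root\<close>).

  The rest is Newton's method for a convex increasing function started to the right of its root.
  The derivative of \<open>eta \<alpha>\<close> decreases from \<open>k\<close> to \<open>1 / k\<close> on \<open>{0..pi}\<close>, so
  \<open>h \<alpha> n j\<close> is convex with derivative at least \<open>n - k > 0\<close>: the iterates decrease towards the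
  root \<open>z\<close>, and each step contracts the error by \<open>1 - h'(z) / h'(y)\<close>, which is at most
  \<open>1 - (n - k) / (n - 1 / k) = (k\<^sup>2 - 1) / (k n - 1)\<close>. The derivative of \<open>eta \<alpha>\<close> is
  Lipschitz with constant \<open>(k\<^sup>2 - 1) / 2\<close>, so each step also satisfies the quadratic estimate with
  factor \<open>(k\<^sup>2 - 1) / (4 h'(y))\<close>; if \<open>n \<ge> 2 k\<close> then \<open>h' \<ge> n / 2\<close> and the factor is at most
  \<open>k\<^sup>2 / (2 n)\<close>. The initial error is at most the length \<open>pi / n\<close> of the domain.
\<close>

section \<open>Newton's method for an increasing convex function\<close>

text \<open>By the mean value theorem \<open>f y = f' \<xi> (y - z)\<close>, so the step multiplies the error by
  \<open>1 - f' \<xi> / f' y\<close>, and monotonicity of \<open>f'\<close> places this factor between 0 and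
  \<open>1 - f' z / f' y\<close>.\<close>

lemma newton_step_convex:
  fixes f f' :: "real \<Rightarrow> real"
  assumes zy: "z \<le> y" and root: "f z = 0"
    and der: "\<And>x. x \<in> {z..y} \<Longrightarrow> (f has_real_derivative f' x) (at x)"
    and pos: "\<And>x. x \<in> {z..y} \<Longrightarrow> 0 < f' x"
    and mono: "\<And>u v. z \<le> u \<Longrightarrow> u \<le> v \<Longrightarrow> v \<le> y \<Longrightarrow> f' u \<le> f' v"
  shows "z \<le> y - f y / f' y" and "y - f y / f' y \<le> y"
    and "y - f y / f' y - z \<le> (1 - f' z / f' y) * (y - z)"
proof -
  have posy: "0 < f' y" using pos zy by simp
  obtain \<xi> where \<xi>: "z \<le> \<xi>" "\<xi> \<le> y" "f y = f' \<xi> * (y - z)"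
  proof (cases "z = y")
    case True
    then show ?thesis using root by (intro that[of z]) auto
  next
    case False
    then have "z < y" using zy by simp
    from MVT2[OF this der] obtain \<xi> where "z < \<xi>" "\<xi> < y" "f y - f z = (y - z) * f' \<xi>"
      by auto
    then show ?thesis using root by (intro that[of \<xi>]) (auto simp: mult.commute)
  qed
  have le: "f' z \<le> f' \<xi>" "f' \<xi> \<le> f' y" using mono \<xi> by auto
  have quot: "f y / f' y = f' \<xi> / f' y * (y - z)" using \<xi> by simp
  have "f' \<xi> / f' y \<le> 1" using le posy by simp
  then have "f' \<xi> / f' y * (y - z) \<le> 1 * (y - z)" using zy by (intro mult_right_mono) auto
  then show "z \<le> y - f y / f' y" unfolding quot by simp
  have "0 < f' \<xi>" using pos \<xi> by simp
  then show "y - f y / f' y \<le> y" unfolding quot using posy zy by simp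
  have "f' z / f' y * (y - z) \<le> f' \<xi> / f' y * (y - z)"
    using le posy zy by (intro mult_right_mono divide_right_mono) auto
  then show "y - f y / f' y - z \<le> (1 - f' z / f' y) * (y - z)"
    unfolding quot by (simp add: algebra_simps)
qed

text \<open>A one-sided Lipschitz bound on \<open>f'\<close> takes the place of a second derivative: it makes \<open>f\<close> minus
  its tangent at \<open>y\<close> minus \<open>M (t - y)\<^sup>2 / 2\<close> an increasing function of \<open>t\<close>. Integrating the
  bound in this way, and not just using the mean value theorem, gives the factor 1/2.\<close>

lemma newton_step_quadratic:
  fixes f f' :: "real \<Rightarrow> real"
  assumes zy: "z \<le> y" and root: "f z = 0"
    and der: "\<And>x. x \<in> {z..y} \<Longrightarrow> (f has_real_derivative f' x) (at x)"
    and pos: "0 < f' y"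
    and lip: "\<And>x. x \<in> {z..y} \<Longrightarrow> f' y - f' x \<le> M * (y - x)"
  shows "y - f y / f' y - z \<le> M / (2 * f' y) * (y - z)\<^sup>2"
proof -
  define \<phi> where "\<phi> = (\<lambda>t. f t - f' y * (t - y) - M * (t - y)\<^sup>2 / 2)"
  have "\<phi> z \<le> \<phi> y"
  proof (rule DERIV_nonneg_imp_nondecreasing[OF zy])
    fix x assume x: "z \<le> x" "x \<le> y"
    have "(\<phi> has_real_derivative f' x - f' y - M * (x - y)) (at x)"
      unfolding \<phi>_def using der[of x] x by (auto intro!: derivative_eq_intros)
    moreover have "0 \<le> f' x - f' y - M * (x - y)" using lip[of x] x by (simp add: algebra_simps)
    ultimately show "\<exists>D. (\<phi> has_real_derivative D) (at x) \<and> 0 \<le> D" by blast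
  qed
  then have "f' y * (y - z) - f y \<le> M * (y - z)\<^sup>2 / 2"
    using root by (simp add: \<phi>_def power2_commute[of z] algebra_simps)
  then have "(f' y * (y - z) - f y) / f' y \<le> (M * (y - z)\<^sup>2 / 2) / f' y"
    using pos by (intro divide_right_mono) auto
  then show ?thesis using pos by (simp add: diff_divide_distrib)
qed

lemma linear_error_bound:
  fixes e :: "nat \<Rightarrow> real"
  assumes "e 0 \<le> B" and "0 \<le> q" and step: "\<And>m. e (Suc m) \<le> q * e m"
  shows "e m \<le> B * q ^ m"
proof (induction m)
  case (Suc m)
  have "e (Suc m) \<le> q * (B * q ^ m)"
    using step[of m] mult_left_mono[OF Suc \<open>0 \<le> q\<close>] by linarith
  then show ?case by (simp add: algebra_simps)
qed (use assms in simp)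

text \<open>The quantity \<open>c e\<close> is at most squared in each step; the exponent is \<open>2 ^ m - 1\<close> because one
  factor \<open>c B\<close> is traded for the prefactor \<open>B\<close>.\<close>

lemma quadratic_error_bound:
  fixes e :: "nat \<Rightarrow> real"
  assumes "e 0 \<le> B" and "0 \<le> c" and nonneg: "\<And>m. 0 \<le> e m"
    and step: "\<And>m. e (Suc m) \<le> c * (e m)\<^sup>2"
  shows "e m \<le> B * (c * B) ^ (2 ^ m - 1)"
proof (induction m)
  case (Suc m)
  have exp: "(2::nat) ^ Suc m - 1 = Suc (2 * (2 ^ m - 1))"
    by (cases "(2::nat) ^ m") auto
  have "(e m)\<^sup>2 \<le> (B * (c * B) ^ (2 ^ m - 1))\<^sup>2"
    using Suc nonneg by (intro power_mono)
  then have "e (Suc m) \<le> c * (B * (c * B) ^ (2 ^ m - 1))\<^sup>2"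
    using step[of m] mult_left_mono[OF _ \<open>0 \<le> c\<close>] by fastforce
  also have "\<dots> = B * (c * B) ^ (2 ^ Suc m - 1)"
    unfolding exp by (simp only: power_Suc power_even_eq power_mult_distrib)
      (simp add: power2_eq_square algebra_simps)
  finally show ?case .
qed (use assms in simp)

section \<open>The phase shift and its derivative\<close>

lemma kap_gt_1: "\<alpha> < 0 \<Longrightarrow> 1 < kap \<alpha>"
  by (simp add: kap_def field_simps)

lemma kap_less_N_min: "kap \<alpha> < real (N_min \<alpha>)"
  unfolding N_min_def by linarith

text \<open>Half of the denominator is \<open>cos\<^sup>2 (x / 2) + k\<^sup>2 sin\<^sup>2 (x / 2)\<close>, which appears when the
  arctangent is differentiated. Written in terms of \<open>cos x\<close>, it depends monotonically on \<open>x\<close> in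
  a visible way.\<close>

definition eta_deriv :: "real \<Rightarrow> real \<Rightarrow> real" where
  "eta_deriv k x = 2 * k / ((k\<^sup>2 + 1) - (k\<^sup>2 - 1) * cos x)"

lemma eta_has_derivative:
  assumes "\<bar>x\<bar> < pi"
  shows "(eta \<alpha> has_real_derivative eta_deriv (kap \<alpha>) x) (at x)"
proof -
  define k where "k = kap \<alpha>"
  let ?c = "cos (x / 2)" and ?s = "sin (x / 2)"
  have c: "0 < ?c" using assms by (intro cos_gt_zero_pi) auto
  have s2: "?s\<^sup>2 = 1 - ?c\<^sup>2" by (simp add: sin_squared_eq)
  have cosx: "cos x = ?c\<^sup>2 - ?s\<^sup>2" using cos_double[of "x / 2"] by simp
  have "(k\<^sup>2 + 1) - (k\<^sup>2 - 1) * cos x = 2 * (?c\<^sup>2 + k\<^sup>2 * ?s\<^sup>2)"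
    unfolding cosx s2 by (simp add: algebra_simps)
  then have der: "eta_deriv k x = k / (?c\<^sup>2 + k\<^sup>2 * ?s\<^sup>2)"
    unfolding eta_deriv_def by (simp only: mult_divide_mult_cancel_left_if) simp
  have "0 < ?c\<^sup>2 + k\<^sup>2 * ?s\<^sup>2" using c by (intro add_pos_nonneg) auto
  then have eq: "2 * ((k * (inverse (?c\<^sup>2) * (1 / 2))) / (1 + (k * tan (x / 2))\<^sup>2)) = eta_deriv k x"
    unfolding der tan_def using c by (simp add: field_simps power_mult_distrib)
  have "((\<lambda>x. 2 * arctan (k * tan (x / 2)) - pi) has_real_derivative eta_deriv k x) (at x)"
    unfolding eq[symmetric] using c
    by (auto intro!: derivative_eq_intros simp: field_simps)
  moreover have "\<forall>\<^sub>F y in nhds x. eta \<alpha> y = 2 * arctan (k * tan (y / 2)) - pi"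
  proof -
    have "\<forall>\<^sub>F y in nhds x. y \<noteq> pi" using assms by (intro t1_space_nhds) auto
    then show ?thesis by eventually_elim (simp add: eta_def k_def)
  qed
  ultimately show ?thesis unfolding k_def
    by (subst DERIV_cong_ev[OF refl _ refl])
qed

lemma eta_bounds:
  assumes "\<alpha> < 0" "0 < x" "x < pi"
  shows "- pi < eta \<alpha> x" and "eta \<alpha> x < 0"
proof -
  have "0 < tan (x / 2)" using assms by (intro tan_gt_zero) auto
  then have "0 < kap \<alpha> * tan (x / 2)" using kap_gt_1[OF assms(1)] by simp
  then have "0 < arctan (kap \<alpha> * tan (x / 2))" by simp
  then show "- pi < eta \<alpha> x" using assms by (simp add: eta_def)
  show "eta \<alpha> x < 0" using assms arctan_ubound[of "kap \<alpha> * tan (x / 2)"] by (simp add: eta_def)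
qed

context
  fixes k :: real
  assumes k: "1 < k"
begin

lemma k_square_gt_1: "1 < k\<^sup>2" using k by (simp add: one_less_power)

lemma eta_denom_bounds:
  "2 \<le> (k\<^sup>2 + 1) - (k\<^sup>2 - 1) * cos x" "(k\<^sup>2 + 1) - (k\<^sup>2 - 1) * cos x \<le> 2 * k\<^sup>2"
proof -
  have "(k\<^sup>2 - 1) * cos x \<le> (k\<^sup>2 - 1) * 1" "(k\<^sup>2 - 1) * (- 1) \<le> (k\<^sup>2 - 1) * cos x"
    using k_square_gt_1 by (intro mult_left_mono; simp)+
  then show "2 \<le> (k\<^sup>2 + 1) - (k\<^sup>2 - 1) * cos x" "(k\<^sup>2 + 1) - (k\<^sup>2 - 1) * cos x \<le> 2 * k\<^sup>2"
    by (simp_all add: algebra_simps)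
qed

text \<open>Cauchy-Schwarz for the vectors \<open>(k\<^sup>2 - 1, 2 k)\<close>, of length \<open>k\<^sup>2 + 1\<close>, and
  \<open>(cos x, sin x)\<close>. It bounds the numerator of the second derivative of \<open>eta\<close> by the
  denominator.\<close>

lemma eta_denom_ge_sin: "2 * k * sin x \<le> (k\<^sup>2 + 1) - (k\<^sup>2 - 1) * cos x"
proof -
  have "((k\<^sup>2 - 1) * c + 2 * k * s)\<^sup>2 + ((k\<^sup>2 - 1) * s - 2 * k * c)\<^sup>2
      = (k\<^sup>2 + 1)\<^sup>2 * (s\<^sup>2 + c\<^sup>2)" for c s :: real
    by (simp add: power2_eq_square algebra_simps)
  from this[of "cos x" "sin x"] have "((k\<^sup>2 - 1) * cos x + 2 * k * sin x)\<^sup>2 + ((k\<^sup>2 - 1) * sin x - 2 * k * cos x)\<^sup>2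
      = (k\<^sup>2 + 1)\<^sup>2"
    by simp
  then have "((k\<^sup>2 - 1) * cos x + 2 * k * sin x)\<^sup>2 \<le> (k\<^sup>2 + 1)\<^sup>2"
    by (metis le_add_same_cancel1 zero_le_power2)
  then have "(k\<^sup>2 - 1) * cos x + 2 * k * sin x \<le> k\<^sup>2 + 1"
    by (rule power2_le_imp_le) simp
  then show ?thesis by simp
qed

lemma eta_deriv_le: "eta_deriv k x \<le> k"
proof -
  have "2 * k / ((k\<^sup>2 + 1) - (k\<^sup>2 - 1) * cos x) \<le> 2 * k / 2"
    using k eta_denom_bounds[of x] by (intro divide_left_mono) auto
  then show ?thesis by (simp add: eta_deriv_def)
qed

lemma eta_deriv_ge: "1 / k \<le> eta_deriv k x"
proof -
  have "2 * k / (2 * k\<^sup>2) \<le> 2 * k / ((k\<^sup>2 + 1) - (k\<^sup>2 - 1) * cos x)"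
    using k eta_denom_bounds(1)[of x]
    by (intro divide_left_mono[OF eta_denom_bounds(2)] mult_pos_pos) auto
  then show ?thesis using k by (simp add: eta_deriv_def power2_eq_square)
qed

lemma eta_deriv_antimono:
  assumes "0 \<le> x" "x \<le> y" "y \<le> pi"
  shows "eta_deriv k y \<le> eta_deriv k x"
proof -
  have "cos y \<le> cos x" using assms by (intro cos_monotone_0_pi_le) auto
  then have "(k\<^sup>2 - 1) * cos y \<le> (k\<^sup>2 - 1) * cos x"
    using k_square_gt_1 by (intro mult_left_mono) auto
  then show ?thesis unfolding eta_deriv_def
    using k eta_denom_bounds(1)[of x] eta_denom_bounds(1)[of y]
    by (intro divide_left_mono mult_pos_pos) auto
qed

text \<open>With \<open>E\<close> the denominator of \<open>eta_deriv\<close>, the derivative of \<open>eta_deriv k\<close> is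
  \<open>- (k\<^sup>2 - 1) (2 k sin t) / E\<^sup>2\<close>. One factor \<open>E\<close> absorbs \<open>2 k sin t\<close> and the other is at
  least 2.\<close>

lemma eta_deriv_lipschitz:
  assumes "0 \<le> x" "x \<le> y" "y \<le> pi"
  shows "eta_deriv k x - eta_deriv k y \<le> (k\<^sup>2 - 1) / 2 * (y - x)"
proof -
  define E where "E = (\<lambda>t. (k\<^sup>2 + 1) - (k\<^sup>2 - 1) * cos t)"
  define \<psi> where "\<psi> = (\<lambda>t. eta_deriv k t + (k\<^sup>2 - 1) / 2 * t)"
  have "\<psi> x \<le> \<psi> y"
  proof (rule DERIV_nonneg_imp_nondecreasing[OF assms(2)])
    fix t assume t: "x \<le> t" "t \<le> y"
    have E: "2 \<le> E t" "2 * k * sin t \<le> E t"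
      using eta_denom_bounds(1) eta_denom_ge_sin by (auto simp: E_def)
    have "(\<psi> has_real_derivative - (2 * k * ((k\<^sup>2 - 1) * sin t)) / (E t)\<^sup>2 + (k\<^sup>2 - 1) / 2) (at t)"
    proof -
      have "(E has_real_derivative (k\<^sup>2 - 1) * sin t) (at t)"
        unfolding E_def by (auto intro!: derivative_eq_intros)
      moreover have "\<psi> = (\<lambda>t. 2 * k / E t + (k\<^sup>2 - 1) / 2 * t)"
        by (rule ext) (simp add: \<psi>_def eta_deriv_def E_def)
      ultimately show ?thesis using E
        by (auto intro!: derivative_eq_intros simp: power2_eq_square)
    qed
    moreover have "2 * k * ((k\<^sup>2 - 1) * sin t) / (E t)\<^sup>2 \<le> (k\<^sup>2 - 1) / 2"
    proof -
      have "2 * k * sin t * 2 \<le> E t * E t"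
        using E by (meson mult_left_mono mult_right_mono order_trans zero_le_numeral)
      then have "(k\<^sup>2 - 1) * (2 * k * sin t * 2) \<le> (k\<^sup>2 - 1) * (E t * E t)"
        using k_square_gt_1 by (intro mult_left_mono) auto
      then show ?thesis using E by (simp add: field_simps power2_eq_square)
    qed
    ultimately show "\<exists>D. (\<psi> has_real_derivative D) (at t) \<and> 0 \<le> D"
      by (intro exI conjI) auto
  qed
  then show ?thesis by (simp add: \<psi>_def algebra_simps diff_divide_distrib)
qed

end

section \<open>The functions \<open>h\<close> and their roots\<close>

lemma d_diff: "0 < n \<Longrightarrow> 1 \<le> j \<Longrightarrow> d n j - d n (j - 1) = pi / real n"
  by (simp add: d_def of_nat_diff field_simps)

lemma d_less_pi: "1 \<le> j \<Longrightarrow> j \<le> n \<Longrightarrow> d n j < pi"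
  using pi_gt_zero by (simp add: d_def pos_divide_less_eq mult.commute)

lemma d_strict_mono: "0 < n \<Longrightarrow> i < j \<Longrightarrow> d n i < d n j"
  by (simp add: d_def divide_strict_right_mono)

lemma d_mono: "i \<le> j \<Longrightarrow> d n i \<le> d n j"
  by (simp add: d_def divide_right_mono mult_right_mono)

lemma d_pred_pos: "3 \<le> j \<Longrightarrow> j \<le> n \<Longrightarrow> 0 < d n (j - 1)"
  by (simp add: d_def of_nat_diff)

lemma h_has_derivative:
  assumes "\<bar>x\<bar> < pi"
  shows "(h \<alpha> n j has_real_derivative real n - eta_deriv (kap \<alpha>) x) (at x)"
proof -
  have eq: "h \<alpha> n j = (\<lambda>x. real n * x - (real j - 1) * pi - eta \<alpha> x)"
    by (rule ext) (simp add: h_def)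
  show ?thesis unfolding eq
    by (auto intro!: derivative_eq_intros eta_has_derivative assms)
qed

text \<open>At the right endpoint \<open>h\<close> equals \<open>- eta > 0\<close>, at the left endpoint it equals
  \<open>- pi - eta < 0\<close>. The left inequality is strict only if the left endpoint is not 0, whence
  \<open>3 \<le> j\<close>.\<close>

lemma h_has_root:
  assumes \<alpha>: "\<alpha> < 0" and j: "3 \<le> j" "j \<le> n"
  obtains z where "d n (j - 1) < z" "z < d n j" "h \<alpha> n j z = 0"
proof -
  have n: "0 < n" using j by simp
  have pos: "0 < d n (j - 1)" and lt: "d n (j - 1) < d n j" and pi: "d n j < pi"
    using d_pred_pos[of j n] d_strict_mono[OF n, of "j - 1" j] d_less_pi[of j n] j by auto
  have "real n * d n (j - 1) = (real j - 1) * pi - pi"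
    using n j by (simp add: d_def of_nat_diff field_simps)
  then have l: "h \<alpha> n j (d n (j - 1)) < 0"
    using eta_bounds(1)[OF \<alpha> pos] lt pi by (simp add: h_def)
  have r: "0 < h \<alpha> n j (d n j)"
    using eta_bounds(2)[OF \<alpha> _ pi] lt pos n by (simp add: h_def d_def)
  have "continuous_on {d n (j - 1)..d n j} (h \<alpha> n j)"
    using pos pi
    by (intro continuous_at_imp_continuous_on ballI DERIV_isCont[OF h_has_derivative]) auto
  with l r lt obtain z where z: "d n (j - 1) \<le> z" "z \<le> d n j" "h \<alpha> n j z = 0"
    using IVT'[of "h \<alpha> n j" "d n (j - 1)" 0 "d n j"] by auto
  then have "z \<noteq> d n (j - 1)" "z \<noteq> d n j" using l r by auto
  with z show ?thesis by (intro that[of z]) auto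
qed

lemma h_deriv_eq:
  assumes "2 \<le> j" "j \<le> n" "x \<in> h_dom n j"
  shows "h_deriv \<alpha> n j x = real n - eta_deriv (kap \<alpha>) x"
    and "h \<alpha> n j differentiable (at x within h_dom n j)"
proof -
  have lt: "d n (j - 1) < d n j" using d_strict_mono[of n "j - 1" j] assms by simp
  have "0 \<le> d n (j - 1)" using assms by (simp add: d_def of_nat_diff)
  then have "\<bar>x\<bar> < pi" using d_less_pi[of j n] assms by (auto simp: h_dom_def)
  from has_field_derivative_at_within[OF h_has_derivative[OF this]]
  have der: "(h \<alpha> n j has_real_derivative real n - eta_deriv (kap \<alpha>) x) (at x within h_dom n j)" .
  then show "h \<alpha> n j differentiable (at x within h_dom n j)"
    by (auto simp: real_differentiable_def)
  show "h_deriv \<alpha> n j x = real n - eta_deriv (kap \<alpha>) x"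
    unfolding h_deriv_def h_dom_def
    using vector_derivative_within_closed_interval[OF lt, of x] assms der
    by (simp add: h_dom_def has_real_derivative_iff_has_vector_derivative)
qed

section \<open>Eigenvectors\<close>

text \<open>The sequence \<open>u\<close> extends the eigenvector by one entry on each side: \<open>u 1, \<dots>, u n\<close> are its
  entries. The values \<open>u 0\<close> and \<open>u (n + 1)\<close> are those that turn the first and the last row into
  instances of the interior recursion.\<close>

lemma char_poly_L_mat_root:
  fixes u :: "nat \<Rightarrow> real"
  assumes n: "3 \<le> n"
    and rec: "\<And>k. k < n \<Longrightarrow> u k + u (k + 2) = (2 - \<mu>) * u (k + 1)"
    and left: "u 0 = (1 - \<alpha>) * u 1 + \<alpha> * u n"
    and right: "u (n + 1) = (1 - \<alpha>) * u n + \<alpha> * u 1"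
    and nz: "k0 < n" "u (k0 + 1) \<noteq> 0"
  shows "poly (char_poly (L_mat \<alpha> n)) \<mu> = 0"
proof -
  have car: "L_mat \<alpha> n \<in> carrier_mat n n" by (simp add: L_mat_def)
  define v where "v = vec n (\<lambda>k. u (k + 1))"
  have row: "(\<Sum>k = 0..<n. L_mat \<alpha> n $$ (i, k) * u (k + 1)) = \<mu> * u (i + 1)" (is "?S = _")
    if i: "i < n" for i
  proof -
    obtain m where m: "n = m + 3" using n by (metis add.commute le_iff_add)
    consider "i = 0" | "i = n - 1" | "0 < i" "i < n - 1" using i by linarith
    then show ?thesis
    proof cases
      case 1
      have "?S = (\<Sum>k\<in>{0, 1, n - 1}. L_mat \<alpha> n $$ (i, k) * u (k + 1))"
        using n 1 by (intro sum.mono_neutral_right) (auto simp: L_mat_def)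
      also have "\<dots> = \<mu> * u (i + 1)"
        using 1 left rec[of 0] by (simp add: m L_mat_def eval_nat_numeral algebra_simps)
      finally show ?thesis .
    next
      case 2
      have "?S = (\<Sum>k\<in>{0, n - 2, n - 1}. L_mat \<alpha> n $$ (i, k) * u (k + 1))"
        using n 2 by (intro sum.mono_neutral_right) (auto simp: L_mat_def)
      also have "\<dots> = \<mu> * u (i + 1)"
        using 2 right rec[of "n - 1"]
        by (simp add: m L_mat_def eval_nat_numeral algebra_simps)
      finally show ?thesis .
    next
      case 3
      then obtain i' where i': "i = Suc i'" by (cases i) auto
      have "?S = (\<Sum>k\<in>{i', i, i + 1}. L_mat \<alpha> n $$ (i, k) * u (k + 1))"
        using n 3 i' by (intro sum.mono_neutral_right) (auto simp: L_mat_def)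
      also have "\<dots> = \<mu> * u (i + 1)"
        using 3 i' rec[of i] by (simp add: L_mat_def eval_nat_numeral algebra_simps)
      finally show ?thesis .
    qed
  qed
  have "L_mat \<alpha> n *\<^sub>v v = \<mu> \<cdot>\<^sub>v v"
  proof (rule eq_vecI)
    fix i assume "i < dim_vec (\<mu> \<cdot>\<^sub>v v)"
    then have i: "i < n" by (simp add: v_def)
    then show "(L_mat \<alpha> n *\<^sub>v v) $ i = (\<mu> \<cdot>\<^sub>v v) $ i"
      using row[OF i] car by (simp add: v_def scalar_prod_def)
  qed (use car in \<open>simp add: v_def\<close>)
  moreover have "v $ k0 \<noteq> 0\<^sub>v n $ k0" using nz by (simp add: v_def)
  then have "v \<noteq> 0\<^sub>v n" by blast
  ultimately have "eigenvector (L_mat \<alpha> n) v \<mu>"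
    using car by (simp add: eigenvector_def v_def)
  then show ?thesis
    unfolding eigenvalue_root_char_poly[OF car, symmetric] eigenvalue_def by blast
qed

text \<open>For a vector invariant under reversal the two boundary equations both read \<open>u 0 = u 1\<close>, so
  \<open>\<alpha>\<close> drops out.\<close>

lemma symmetric_eigenvalue:
  assumes n: "3 \<le> n" and x: "0 \<le> x" "x < pi" and sin0: "sin (real n * x / 2) = 0"
  shows "poly (char_poly (L_mat \<alpha> n)) (2 - 2 * cos x) = 0"
proof -
  define u where "u = (\<lambda>k. cos (real k * x - real (n + 1) * x / 2))"
  have ends: "cos (real n * x / 2 + x / 2) = cos (real n * x / 2 - x / 2)"
    using sin0 by (simp add: cos_add cos_diff)
  have u: "u 0 = cos (real n * x / 2 + x / 2)" "u (n + 1) = cos (real n * x / 2 + x / 2)"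
    "u 1 = cos (real n * x / 2 - x / 2)" "u n = cos (real n * x / 2 - x / 2)"
    unfolding u_def
    subgoal by (subst cos_minus[symmetric], rule arg_cong[of _ _ cos]) (simp add: field_simps)
    subgoal by (rule arg_cong[of _ _ cos]) (simp add: field_simps)
    subgoal by (subst cos_minus[symmetric], rule arg_cong[of _ _ cos]) (simp add: field_simps)
    subgoal by (rule arg_cong[of _ _ cos]) (simp add: field_simps)
    done
  show ?thesis
  proof (rule char_poly_L_mat_root[OF n])
    fix k assume "k < n"
    define A where "A = real (k + 1) * x - real (n + 1) * x / 2"
    have "u k = cos (A - x)" "u (k + 2) = cos (A + x)" "u (k + 1) = cos A"
      by (simp_all add: u_def A_def algebra_simps)
    then show "u k + u (k + 2) = (2 - (2 - 2 * cos x)) * u (k + 1)"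
      by (simp add: cos_add cos_diff)
  next
    show "u 0 = (1 - \<alpha>) * u 1 + \<alpha> * u n" "u (n + 1) = (1 - \<alpha>) * u n + \<alpha> * u 1"
      unfolding u ends by (simp_all add: algebra_simps)
  next
    \<comment> \<open>The entry at the centre, or next to it, is \<open>cos 0\<close> or \<open>cos (x / 2)\<close>.\<close>
    show "n div 2 < n" using n by simp
    have c: "0 < cos (x / 2)" using x by (intro cos_gt_zero_pi) auto
    show "u (n div 2 + 1) \<noteq> 0"
    proof (cases "even n")
      case True
      then obtain m where "n = 2 * m" by blast
      then have "u (n div 2 + 1) = cos (x / 2)"
        by (simp add: u_def field_simps)
      then show ?thesis using c by simp
    next
      case False
      then obtain m where "n = 2 * m + 1" by (auto elim: oddE)
      then have "u (n div 2 + 1) = cos 0"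
        unfolding u_def by (intro arg_cong[of _ _ cos]) (simp add: field_simps)
      then show ?thesis by simp
    qed
  qed
qed

text \<open>For a vector negated by reversal the two boundary equations both read
  \<open>u 0 = (1 - 2 \<alpha>) u 1\<close>. The addition formulas turn this into the hypothesis, which is
  \<open>tan (n x / 2) = kap \<alpha> * tan (x / 2)\<close> cleared of denominators.\<close>

lemma antisymmetric_eigenvalue:
  assumes n: "3 \<le> n" and x: "0 < x" "x < pi"
    and eq: "\<alpha> * (sin (real n * x / 2) * cos (x / 2)) = (\<alpha> - 1) * (cos (real n * x / 2) * sin (x / 2))"
  shows "poly (char_poly (L_mat \<alpha> n)) (2 - 2 * cos x) = 0"
proof -
  define u where "u = (\<lambda>k. sin (real k * x - real (n + 1) * x / 2))"
  have ends: "sin (real n * x / 2 + x / 2) = (1 - 2 * \<alpha>) * sin (real n * x / 2 - x / 2)"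
    using eq by (simp add: sin_add sin_diff algebra_simps)
  have u: "u 0 = - sin (real n * x / 2 + x / 2)" "u (n + 1) = sin (real n * x / 2 + x / 2)"
    "u 1 = - sin (real n * x / 2 - x / 2)" "u n = sin (real n * x / 2 - x / 2)"
    unfolding u_def
    subgoal by (subst sin_minus[symmetric], rule arg_cong[of _ _ sin]) (simp add: field_simps)
    subgoal by (rule arg_cong[of _ _ sin]) (simp add: field_simps)
    subgoal by (subst sin_minus[symmetric], rule arg_cong[of _ _ sin]) (simp add: field_simps)
    subgoal by (rule arg_cong[of _ _ sin]) (simp add: field_simps)
    done
  show ?thesis
  proof (rule char_poly_L_mat_root[OF n])
    fix k assume "k < n"
    define A where "A = real (k + 1) * x - real (n + 1) * x / 2"
    have "u k = sin (A - x)" "u (k + 2) = sin (A + x)" "u (k + 1) = sin A"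
      by (simp_all add: u_def A_def algebra_simps)
    then show "u k + u (k + 2) = (2 - (2 - 2 * cos x)) * u (k + 1)"
      by (simp add: sin_add sin_diff)
  next
    show "u 0 = (1 - \<alpha>) * u 1 + \<alpha> * u n" "u (n + 1) = (1 - \<alpha>) * u n + \<alpha> * u 1"
      unfolding u ends by (simp_all add: algebra_simps)
  next
    \<comment> \<open>For odd \<open>n\<close> the central entry vanishes, so the one after it is used.\<close>
    show "(n + 1) div 2 < n" using n by simp
    show "u ((n + 1) div 2 + 1) \<noteq> 0"
    proof (cases "even n")
      case True
      then obtain m where "n = 2 * m" by blast
      then have "u ((n + 1) div 2 + 1) = sin (x / 2)"
        by (simp add: u_def field_simps)
      moreover have "0 < sin (x / 2)" using x by (intro sin_gt_zero) auto
      ultimately show ?thesis by simp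
    next
      case False
      then obtain m where "n = 2 * m + 1" by (auto elim: oddE)
      then have "u ((n + 1) div 2 + 1) = sin x"
        unfolding u_def by (intro arg_cong[of _ _ sin]) (simp add: field_simps)
      moreover have "0 < sin x" using x by (intro sin_gt_zero) auto
      ultimately show ?thesis by simp
    qed
  qed
qed

text \<open>The antisymmetric ansatz with \<open>x\<close> imaginary and \<open>r = exp \<bar>x\<bar>\<close>: the vector is
  \<open>r ^ i - r ^ (n + 1 - i)\<close>, and its boundary equation is \<open>g r = 0\<close>. Since \<open>g 1 = 0\<close> and the
  hypothesis \<open>kap \<alpha> < n\<close> says exactly that \<open>g\<close> has positive slope at 1, \<open>g\<close> is positive just
  after 1; at \<open>r = 1 - 2 \<alpha>\<close> the powers of degree \<open>n + 1\<close> cancel and \<open>g r = 1 - r\<^sup>2 < 0\<close>.\<close>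

lemma negative_eigenvalue:
  assumes \<alpha>: "\<alpha> < 0" and n: "3 \<le> n" "kap \<alpha> < real n"
  obtains \<mu> where "\<mu> < 0" "poly (char_poly (L_mat \<alpha> n)) \<mu> = 0"
proof -
  define g where "g = (\<lambda>r::real. 1 - r ^ (n + 1) - (1 - 2 * \<alpha>) * (r - r ^ n))"
  have slope: "0 < - 2 - 2 * \<alpha> * (real n - 1)"
    using n(2) \<alpha> by (simp add: kap_def field_simps)
  have "(g has_real_derivative - 2 - 2 * \<alpha> * (real n - 1)) (at 1)"
    unfolding g_def by (auto intro!: derivative_eq_intros simp: algebra_simps)
  from DERIV_pos_inc_right[OF this slope]
  obtain \<delta> where \<delta>: "0 < \<delta>" "\<And>t. 0 < t \<Longrightarrow> t < \<delta> \<Longrightarrow> g 1 < g (1 + t)" by blast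
  define t where "t = min (\<delta> / 2) (- \<alpha>)"
  have t: "0 < t" "t < \<delta>" "1 + t < 1 - 2 * \<alpha>" using \<delta>(1) \<alpha> by (auto simp: t_def)
  have start: "0 < g (1 + t)" using \<delta>(2)[OF t(1,2)] by (simp add: g_def)
  have "g (1 - 2 * \<alpha>) = 1 - (1 - 2 * \<alpha>)\<^sup>2"
    by (simp add: g_def power2_eq_square algebra_simps)
  also have "\<dots> < 0" using \<alpha> by (simp add: one_less_power)
  finally have "g (1 - 2 * \<alpha>) < 0" .
  moreover have "continuous_on {1 + t..1 - 2 * \<alpha>} g"
    unfolding g_def by (intro continuous_intros)
  ultimately obtain r where r: "1 + t \<le> r" "g r = 0"
    using IVT2'[of g "1 - 2 * \<alpha>" 0 "1 + t"] start t(3) by auto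
  have r1: "1 < r" using r(1) t(1) by simp
  define u where "u = (\<lambda>k. r ^ k - r ^ (n + 1) / r ^ k)"
  have u: "u 0 = 1 - r ^ (n + 1)" "u (n + 1) = - u 0" "u 1 = r - r ^ n" "u n = - u 1"
    using r1 by (simp_all add: u_def)
  have u0: "u 0 = (1 - 2 * \<alpha>) * u 1" 
    unfolding u(1,3) using r(2) by (simp add: g_def)
  show ?thesis
  proof (rule that)
    have "2 * r < r\<^sup>2 + 1" using r1 zero_less_power2[of "r - 1"]
      by (simp add: power2_eq_square algebra_simps)
    then show "2 - (r + 1 / r) < 0" using r1 by (simp add: field_simps power2_eq_square)
    show "poly (char_poly (L_mat \<alpha> n)) (2 - (r + 1 / r)) = 0"
    proof (rule char_poly_L_mat_root[OF n(1)])
      fix k assume "k < n"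
      show "u k + u (k + 2) = (2 - (2 - (r + 1 / r))) * u (k + 1)"
        using r1 by (simp add: u_def field_simps)
    next
      show "u 0 = (1 - \<alpha>) * u 1 + \<alpha> * u n" "u (n + 1) = (1 - \<alpha>) * u n + \<alpha> * u 1"
        unfolding u(2,4) u0 by (simp_all add: algebra_simps)
    next
      show "0 < n" using n by simp
      have "r ^ 1 < r ^ n" using r1 n by (intro power_strict_increasing) auto
      then have "u 1 \<noteq> 0" unfolding u(3) by simp
      then show "u (0 + 1) \<noteq> 0" by simp
    qed
  qed
qed

section \<open>Identification of the eigenvalues\<close>

text \<open>As many distinct roots as the degree leave no room for others, nor for multiplicities.\<close>

lemma sorted_proots_nth:
  fixes p :: "real poly"
  assumes p: "p \<noteq> 0" "degree p = n"
    and mono: "strict_mono_on {1..n} f"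
    and roots: "\<And>i. i \<in> {1..n} \<Longrightarrow> poly p (f i) = 0"
    and j: "j \<in> {1..n}"
  shows "sorted_list_of_multiset (proots p) ! (j - 1) = f j"
proof -
  define xs where "xs = map f [1..<Suc n]"
  have sorted: "sorted_wrt (<) xs"
    unfolding xs_def sorted_wrt_map
    by (rule sorted_wrt_mono_rel[OF _ sorted_wrt_upt]) (use strict_mono_onD[OF mono] in auto)
  then have dist: "distinct xs" by (simp add: strict_sorted_iff)
  have "mset xs \<subseteq># proots p"
  proof -
    have "mset xs = mset_set (set xs)" using dist by (simp add: mset_set_set)
    also have "\<dots> \<subseteq># mset_set (set_mset (proots p))"
      using p(1) roots
      by (intro subset_imp_msubset_mset_set finite_set_mset) (auto simp: xs_def)
    also have "\<dots> \<subseteq># proots p" by (rule mset_set_set_mset_msubset)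
    finally show ?thesis .
  qed
  moreover have "size (proots p) \<le> size (mset xs)"
    using size_proots_le[of p] p(2) by (simp add: xs_def del: upt_Suc)
  ultimately have "mset xs = proots p"
    by (metis leD mset_subset_size subset_mset.le_imp_less_or_eq)
  then have "sorted_list_of_multiset (proots p) = sort xs"
    by (metis sorted_list_of_multiset_mset)
  also have "\<dots> = xs" using sorted by (simp add: sorted_sort_id strict_sorted_iff)
  also have "xs ! (j - 1) = f ([1..<Suc n] ! (j - 1))"
    unfolding xs_def using j by (intro nth_map) (auto simp del: upt_Suc)
  also have "[1..<Suc n] ! (j - 1) = j" using j by (subst nth_upt) auto
  finally show ?thesis .
qed

text \<open>Unfolding \<open>eta\<close>, the equation \<open>h \<alpha> n j x = 0\<close> says that \<open>n x / 2\<close> and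
  \<open>arctan (kap \<alpha> * tan (x / 2))\<close> differ by \<open>(j - 2) pi / 2\<close>, a multiple of \<open>pi\<close> because \<open>j\<close>
  is even; hence they have the same tangent.\<close>

lemma h_root_eigenvalue:
  assumes \<alpha>: "\<alpha> < 0" and n: "3 \<le> n" and j: "even j" "2 \<le> j"
    and x: "0 < x" "x < pi" and root: "h \<alpha> n j x = 0"
  shows "poly (char_poly (L_mat \<alpha> n)) (2 - 2 * cos x) = 0"
proof (rule antisymmetric_eigenvalue[OF n x])
  define \<theta> where "\<theta> = arctan (kap \<alpha> * tan (x / 2))"
  obtain i where "j = 2 * i" using j by blast
  then obtain i where i: "j = 2 * i + 2" using j by (cases i) auto
  have c: "0 < cos (x / 2)" using x by (intro cos_gt_zero_pi) auto
  have nx: "real n * x / 2 = real i * pi + \<theta>"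
    using root x by (simp add: h_def eta_def \<theta>_def i field_simps)
  have sc: "sin (real n * x / 2) = (- 1) ^ i * sin \<theta>" "cos (real n * x / 2) = (- 1) ^ i * cos \<theta>"
    unfolding nx by (simp_all add: sin_add cos_add)
  have "tan \<theta> = kap \<alpha> * tan (x / 2)" by (simp only: \<theta>_def tan_arctan)
  moreover have "0 < cos \<theta>"
    unfolding \<theta>_def using arctan_lbound arctan_ubound by (intro cos_gt_zero_pi)
  ultimately have "sin \<theta> * cos (x / 2) = kap \<alpha> * (cos \<theta> * sin (x / 2))"
    using c by (simp add: tan_def field_simps)
  then have "\<alpha> * (sin \<theta> * cos (x / 2)) = (\<alpha> - 1) * (cos \<theta> * sin (x / 2))"
    using \<alpha> by (simp add: kap_def)
  then have "(- 1) ^ i * (\<alpha> * (sin \<theta> * cos (x / 2)))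
      = (- 1) ^ i * ((\<alpha> - 1) * (cos \<theta> * sin (x / 2)))"
    by (rule arg_cong)
  then show "\<alpha> * (sin (real n * x / 2) * cos (x / 2)) = (\<alpha> - 1) * (cos (real n * x / 2) * sin (x / 2))"
    unfolding sc by (simp only: mult_ac)
qed

text \<open>The eigenvalues are listed as \<open>f 1 < \<dots> < f n\<close>, with \<open>f 1\<close> the negative one and
  \<open>f i = 2 - 2 cos (w i)\<close> otherwise. The angles increase since
  \<open>w i \<le> d n i \<le> d n (i' - 1) < w i'\<close> for \<open>2 \<le> i < i'\<close>.\<close>

lemma eig_angle_h_root:
  assumes \<alpha>: "\<alpha> < 0" and N: "N_min \<alpha> \<le> n" and j: "even j" "4 \<le> j" "j \<le> n"
  shows "eig_angle \<alpha> n j \<in> {d n (j - 1)<..<d n j}" and "h \<alpha> n j (eig_angle \<alpha> n j) = 0"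
proof -
  have n: "3 \<le> n" using N by (simp add: N_min_def)
  have kn: "kap \<alpha> < real n" using kap_less_N_min[of \<alpha>] N by linarith
  obtain \<mu> where \<mu>: "\<mu> < 0" "poly (char_poly (L_mat \<alpha> n)) \<mu> = 0"
    using negative_eigenvalue[OF \<alpha> n kn] .
  have "\<exists>z. \<forall>i. 3 \<le> i \<longrightarrow> i \<le> n \<longrightarrow> d n (i - 1) < z i \<and> z i < d n i \<and> h \<alpha> n i (z i) = 0"
    using h_has_root[OF \<alpha>, of _ n] by (intro choice) metis
  then obtain z where
    z: "\<And>i. 3 \<le> i \<Longrightarrow> i \<le> n \<Longrightarrow> d n (i - 1) < z i \<and> z i < d n i \<and> h \<alpha> n i (z i) = 0"
    by blast
  \<comment> \<open>Index 2 carries the angle 0 of the constant eigenvector, which would be \<open>d n 1\<close>.\<close>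
  define w where "w = (\<lambda>i. if i = 2 then 0 else if even i then z i else d n i)"
  have w_upper: "w i \<le> d n i" if "2 \<le> i" "i \<le> n" for i
  proof (cases "i = 2")
    case True
    then show ?thesis by (simp add: w_def d_def)
  next
    case False
    then show ?thesis using z[of i] that by (simp add: w_def)
  qed
  have w_lower: "d n (i - 1) < w i" if "3 \<le> i" "i \<le> n" for i
    using z[OF that] d_strict_mono[of n "i - 1" i] that by (simp add: w_def)
  have w_nonneg: "0 \<le> w i" if "2 \<le> i" "i \<le> n" for i
  proof (cases "i = 2")
    case False
    then show ?thesis using w_lower[of i] d_pred_pos[of i n] that by simp
  qed (simp add: w_def)
  have w_pi: "w i < pi" if "2 \<le> i" "i \<le> n" for i
    using w_upper[OF that] d_less_pi[of i n] that by simp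
  define f where "f = (\<lambda>i. if i = 1 then \<mu> else 2 - 2 * cos (w i))"
  have "strict_mono_on {1..n} f"
  proof (rule strict_mono_onI)
    fix i i' :: nat assume ii: "i \<in> {1..n}" "i' \<in> {1..n}" "i < i'"
    show "f i < f i'"
    proof (cases "i = 1")
      case True
      have "0 \<le> 2 - 2 * cos (w i')" by simp
      then have "\<mu> < 2 - 2 * cos (w i')" using \<mu>(1) by linarith
      then show ?thesis using True ii by (simp add: f_def)
    next
      case False
      then have "w i \<le> d n i" using ii w_upper[of i] by simp
      also have "\<dots> \<le> d n (i' - 1)" using ii by (intro d_mono) simp
      also have "\<dots> < w i'" using ii False w_lower[of i'] by simp
      finally have "cos (w i') < cos (w i)"
        using ii False w_nonneg[of i] w_pi[of i'] by (intro cos_monotone_0_pi) auto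
      then show ?thesis using ii False by (simp add: f_def)
    qed
  qed
  moreover have "poly (char_poly (L_mat \<alpha> n)) (f i) = 0" if i: "i \<in> {1..n}" for i
  proof -
    consider "i = 1" | "i = 2" | "even i" "3 \<le> i" | "odd i" "3 \<le> i" using i by fastforce
    then show ?thesis
    proof cases
      case 1
      then show ?thesis using \<mu> by (simp add: f_def)
    next
      case 2
      then show ?thesis using symmetric_eigenvalue[OF n, of 0 \<alpha>] by (simp add: f_def w_def)
    next
      case 3
      then have "0 < w i" using d_pred_pos[of i n] w_lower[of i] i by simp
      then show ?thesis
        using h_root_eigenvalue[OF \<alpha> n, of i "w i"] 3 i z[of i] w_pi[of i] by (simp add: f_def w_def)
    next
      case 4
      then obtain m where m: "i = 2 * m + 1" by (auto elim: oddE)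
      have "real n * w i / 2 = real m * pi" using 4 n by (simp add: w_def m d_def)
      then have "sin (real n * w i / 2) = 0" by simp
      then show ?thesis
        using symmetric_eigenvalue[OF n, of "w i" \<alpha>] w_nonneg[of i] w_pi[of i] 4 i by (simp add: f_def)
    qed
  qed
  moreover have "degree (char_poly (L_mat \<alpha> n)) = n" "char_poly (L_mat \<alpha> n) \<noteq> 0"
    using degree_monic_char_poly[of "L_mat \<alpha> n" n] by (auto simp: L_mat_def)
  ultimately have "eigval \<alpha> n j = f j"
    unfolding eigval_def using j by (intro sorted_proots_nth) auto
  then have eig: "eigval \<alpha> n j = 2 - 2 * cos (z j)" using j by (simp add: f_def w_def)
  have half: "4 * (sin (t / 2))\<^sup>2 = 2 - 2 * cos t" for t :: real
    using cos_double_sin[of "t / 2"] by simp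
  have zj: "w j = z j" using j by (simp add: w_def)
  have "eig_angle \<alpha> n j = z j"
    unfolding eig_angle_def half eig
  proof (rule the_equality)
    show "z j \<in> {0..pi} \<and> 2 - 2 * cos (z j) = 2 - 2 * cos (z j)"
      using w_nonneg[of j] w_pi[of j] j zj by simp
    fix t assume t: "t \<in> {0..pi} \<and> 2 - 2 * cos t = 2 - 2 * cos (z j)"
    have "0 \<le> z j" "z j \<le> pi" using w_nonneg[of j] w_pi[of j] j zj by simp_all
    moreover have "cos t = cos (z j)" using t by simp
    ultimately show "t = z j" using t by (auto intro: cos_inj_pi)
  qed
  then show "eig_angle \<alpha> n j \<in> {d n (j - 1)<..<d n j}" "h \<alpha> n j (eig_angle \<alpha> n j) = 0"
    using z[of j] j by auto
qed

section \<open>Convergence of the Newton sequence\<close>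

theorem theorem4p4:
  fixes \<alpha> :: real and n j :: nat
  assumes "\<alpha> < 0" and "n \<ge> N_min \<alpha>"
    and "even j" and "4 \<le> j" and "j \<le> n"
  shows "newton_well_defined \<alpha> n j \<and>
    newton \<alpha> n j \<longlonglongrightarrow> eig_angle \<alpha> n j \<and>
    converges_with_order 1 (newton \<alpha> n j) (eig_angle \<alpha> n j) \<and>
    (\<forall>m. newton \<alpha> n j m - eig_angle \<alpha> n j
         \<le> pi / real n * (((kap \<alpha>)\<^sup>2 - 1) / (kap \<alpha> * real n - 1)) ^ m) \<and>
    (n \<ge> 2 * N_min \<alpha> \<longrightarrow>
       converges_with_order 2 (newton \<alpha> n j) (eig_angle \<alpha> n j) \<and>
       (\<forall>m. newton \<alpha> n j m - eig_angle \<alpha> n j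
            \<le> pi / real n * (pi * (kap \<alpha>)\<^sup>2 / (2 * (real n)\<^sup>2)) ^ (2 ^ m - 1)))"
proof -
  define k where "k = kap \<alpha>"
  define z where "z = eig_angle \<alpha> n j"
  define y where "y = newton \<alpha> n j"
  define h' where "h' = (\<lambda>x. real n - eta_deriv k x)"
  have k: "1 < k" using kap_gt_1 assms(1) by (simp add: k_def)
  have kn: "k < real n" using kap_less_N_min[of \<alpha>] assms(2) unfolding k_def by linarith
  have n: "0 < real n" using assms by simp
  have z: "d n (j - 1) < z" "z < d n j" and root: "h \<alpha> n j z = 0"
    using eig_angle_h_root[OF assms] by (auto simp: z_def)
  have z0: "0 < z" using z d_pred_pos[of j n] assms by simp
  have pi: "d n j < pi" using d_less_pi assms by simp
  have der: "(h \<alpha> n j has_real_derivative h' x) (at x)" if "z \<le> x" "x \<le> d n j" for x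
    unfolding h'_def k_def using that z0 pi by (intro h_has_derivative) auto
  have h'_pos: "0 < h' x" for x using eta_deriv_le[OF k, of x] kn by (simp add: h'_def)
  have h'_mono: "h' u \<le> h' v" if "z \<le> u" "u \<le> v" "v \<le> d n j" for u v
    using eta_deriv_antimono[OF k, of u v] that z0 pi by (simp add: h'_def)
  have h_deriv: "h_deriv \<alpha> n j x = h' x" and diff: "h \<alpha> n j differentiable (at x within h_dom n j)"
    if "z \<le> x" "x \<le> d n j" for x
    using h_deriv_eq[of j n x \<alpha>] that z assms by (auto simp: h'_def k_def h_dom_def)

  have range: "z \<le> y m \<and> y m \<le> d n j" for m
  proof (induction m)
    case 0
    then show ?case using z by (simp add: y_def)
  next
    case (Suc m)
    then have "y (Suc m) = y m - h \<alpha> n j (y m) / h' (y m)"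
      using h_deriv by (simp add: y_def)
    then show ?case
      using newton_step_convex(1,2)[of z "y m" "h \<alpha> n j" h'] Suc root der h'_pos h'_mono by force
  qed
  have step: "y (Suc m) = y m - h \<alpha> n j (y m) / h' (y m)" for m
    using h_deriv[of "y m"] range by (simp add: y_def)
  have "d n j - d n (j - 1) = pi / real n" using assms by (intro d_diff) auto
  then have e0: "y 0 - z \<le> pi / real n" using z by (simp add: y_def)
  have dom: "y m \<in> h_dom n j" for m
    using range[of m] z by (simp add: h_dom_def)
  have wd: "newton_well_defined \<alpha> n j"
    unfolding newton_well_defined_def y_def[symmetric]
    using range h_deriv diff dom h'_pos by (simp add: less_imp_neq[symmetric])

  define q where "q = (k\<^sup>2 - 1) / (k * real n - 1)"
  have kn1: "0 < k * real n - 1" using k kn mult_strict_mono[of 1 k 1 "real n"] by simp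
  have q0: "0 < q" using k_square_gt_1[OF k] kn1 by (simp add: q_def)
  have "k\<^sup>2 < k * real n" using k kn by (simp add: power2_eq_square)
  then have q1: "q < 1" using kn1 by (simp add: q_def)
  have lin: "y (Suc m) - z \<le> q * (y m - z)" for m
  proof -
    have r: "z \<le> y m" "y m \<le> d n j" using range by auto
    have "y (Suc m) - z \<le> (1 - h' z / h' (y m)) * (y m - z)"
      unfolding step using r by (intro newton_step_convex(3)) (auto intro: root der h'_pos h'_mono)
    also have "\<dots> \<le> q * (y m - z)"
    proof (rule mult_right_mono)
      have le: "h' (y m) \<le> real n - 1 / k" using eta_deriv_ge[OF k] by (simp add: h'_def)
      have "real n - k \<le> h' z" using eta_deriv_le[OF k] by (simp add: h'_def)
      then have "(real n - k) / (real n - 1 / k) \<le> h' z / h' (y m)"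
        using le h'_pos kn by (intro frac_le) auto
      moreover have "1 - (real n - k) / (real n - 1 / k) = q"
        using k kn1 by (simp add: q_def field_simps power2_eq_square)
      ultimately show "1 - h' z / h' (y m) \<le> q" by linarith
    qed (use r in simp)
    finally show ?thesis .
  qed
  have lin_bound: "y m - z \<le> pi / real n * q ^ m" for m
    using q0 by (intro linear_error_bound[of "\<lambda>m. y m - z"] e0 lin) simp
  have conv: "y \<longlonglongrightarrow> z"
  proof -
    have "(\<lambda>m. pi / real n * q ^ m) \<longlonglongrightarrow> pi / real n * 0"
      using q0 q1 by (intro tendsto_mult_left LIMSEQ_power_zero) auto
    then have lim: "(\<lambda>m. pi / real n * q ^ m) \<longlonglongrightarrow> 0" by simp
    have "(\<lambda>m. y m - z) \<longlonglongrightarrow> 0"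
    proof (rule tendsto_sandwich[OF _ _ tendsto_const lim])
      show "\<forall>\<^sub>F m in sequentially. 0 \<le> y m - z" using range by simp
      show "\<forall>\<^sub>F m in sequentially. y m - z \<le> pi / real n * q ^ m"
        using lin_bound by (intro always_eventually allI)
    qed
    then show ?thesis by (rule LIM_zero_cancel)
  qed
  have ord1: "converges_with_order 1 y z"
    unfolding converges_with_order_def
    using conv q0 q1 lin range by (auto intro!: exI[of _ q])

  have quadratic: "converges_with_order 2 y z \<and>
      (\<forall>m. y m - z \<le> pi / real n * (pi * k\<^sup>2 / (2 * (real n)\<^sup>2)) ^ (2 ^ m - 1))"
    if n2: "2 * N_min \<alpha> \<le> n"
  proof -
    define c where "c = k\<^sup>2 / (2 * real n)"
    have c0: "0 < c" using k n by (simp add: c_def)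
    have "2 * k < real n" using kap_less_N_min[of \<alpha>] n2 unfolding k_def by linarith
    then have half: "real n / 2 \<le> h' x" for x using eta_deriv_le[OF k, of x] by (simp add: h'_def)
    have quad: "y (Suc m) - z \<le> c * (y m - z)\<^sup>2" for m
    proof -
      have r: "z \<le> y m" "y m \<le> d n j" using range by auto
      have "y (Suc m) - z \<le> ((k\<^sup>2 - 1) / 2) / (2 * h' (y m)) * (y m - z)\<^sup>2"
        unfolding step
      proof (rule newton_step_quadratic)
        fix x assume "x \<in> {z..y m}"
        then show "h' (y m) - h' x \<le> (k\<^sup>2 - 1) / 2 * (y m - x)"
          using eta_deriv_lipschitz[OF k, of x "y m"] r z0 pi by (simp add: h'_def)
      qed (use r root der h'_pos in auto)
      also have "\<dots> \<le> c * (y m - z)\<^sup>2"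
      proof (rule mult_right_mono)
        have "((k\<^sup>2 - 1) / 2) / (2 * h' (y m)) \<le> (k\<^sup>2 / 2) / real n"
          using half[of "y m"] n by (intro frac_le) auto
        then show "((k\<^sup>2 - 1) / 2) / (2 * h' (y m)) \<le> c" by (simp add: c_def)
      qed simp
      finally show ?thesis .
    qed
    have "c * (pi / real n) = pi * k\<^sup>2 / (2 * (real n)\<^sup>2)"
      by (simp add: c_def power2_eq_square mult_ac)
    moreover have "y m - z \<le> pi / real n * (c * (pi / real n)) ^ (2 ^ m - 1)" for m
      using c0 range by (intro quadratic_error_bound[of "\<lambda>m. y m - z"] e0 quad) auto
    moreover have "converges_with_order 2 y z"
      unfolding converges_with_order_def
      using conv c0 quad range by (auto intro!: exI[of _ c])
    ultimately show ?thesis by simp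
  qed
  show ?thesis
    using wd conv ord1 lin_bound quadratic unfolding y_def z_def q_def k_def by blast
qed

end
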